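(* There exist absolute constants $N_0 \in \mathbf{N}$ and $c_1, c_2 > 0$ such that the following holds. Let $N \geq N_0$ be an integer, let $\delta \in (0,\frac12]$ and let $K > 0$. If $A \subset \mathbf{Z}$ is a set of $N$ integers such that $\|\widehat{1_A}\|_1 \leq K \log N$, then there is a subset $A' \subseteq A$ with $|A'| \geq c_1 N^{1-\delta}$ and $\omega[A'] \geq c_2 (\delta/K)^2$.
   Context: For a finite set $A \subset \mathbf{Z}$, $1_A$ is its indicator function, $\widehat{1_A}(\theta) = \sum_{n \in A} e^{-2\pi i n\theta}$ for $\theta \in \mathbf{R}/\mathbf{Z}$, and $\|\widehat{1_A}\|_1 = \int_0^1 |\widehat{1_A}(\theta)|\,d\theta$. For a finite nonempty set $B \subset \mathbf{Z}$, the additive energy is $E(B) = \#\{(b_1,b_2,b_3,b_4) \in B^4 : b_1+b_2 = b_3+b_4\}$, and the normalised additive energy is $\omega[B] = E(B)/|B|^3$. $\log$ is the natural logarithm. *)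

theory Defs
  imports "HOL-Analysis.Analysis"
begin

(* The sets below are meant to be finite: sum and card are 0 on infinite sets. *)

(* A function on R/Z is rendered as a 1-periodic function on the reals. *)
definition fourier_ind :: "int set \<Rightarrow> real \<Rightarrow> complex" where
  "fourier_ind A \<theta> = (\<Sum>n\<in>A. exp (- 2 * of_real pi * \<i> * of_int n * of_real \<theta>))"

definition fourier_ind_L1 :: "int set \<Rightarrow> real" where
  "fourier_ind_L1 A = integral {0..1} (\<lambda>\<theta>. cmod (fourier_ind A \<theta>))"

definition additive_energy :: "int set \<Rightarrow> nat" where
  "additive_energy B =
     card {(b1, b2, b3, b4). b1 \<in> B \<and> b2 \<in> B \<and> b3 \<in> B \<and> b4 \<in> B \<and> b1 + b2 = b3 + b4}"

(* Takes the junk value 0 at the empty set. *)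
definition normalised_energy :: "int set \<Rightarrow> real" where
  "normalised_energy B = real (additive_energy B) / real (card B) ^ 3"

end

theory Submission
  imports Defs "HOL-Complex_Analysis.Complex_Analysis"
begin

text \<open>
  The argument is a variant of the McGehee--Pigno--Smith proof of the Littlewood conjecture. Let
  \<open>B\<^sub>i\<close> be the set of the \<open>4^i\<close> largest elements of \<open>A\<close>, and let \<open>g\<^sub>i\<close> be the trigonometric
  polynomial with coefficients \<open>c / 4^i\<close> on \<open>B\<^sub>i\<close>, where \<open>c\<close> is a large multiple of \<open>K / \<delta>\<close>. Choose
  polynomials \<open>\<phi>\<^sub>i\<close> with \<open>Re \<phi>\<^sub>i \<ge> |g\<^sub>i|\<close> on the unit circle and with \<open>L\<^sup>2\<close> norm comparable to that
  of \<open>g\<^sub>i\<close>, and put \<open>F = \<Sum>\<^sub>i g\<^sub>i exp (- \<Sum>\<^bsub>k \<ge> i\<^esub> \<phi>\<^sub>k)\<close>.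
  The inequality \<open>(1 + x) exp (- x) \<le> 1\<close> gives \<open>|F| \<le> 1\<close>, so pairing \<open>F\<close> with the exponential
  sum of \<open>A\<close> bounds its \<open>L\<^sup>1\<close> norm from below. The exponential factor has
  only nonnegative frequencies, so that the \<open>i\<close>-th summand sees no element of \<open>A\<close>
  outside \<open>B\<^sub>i\<close>; it contributes \<open>c\<close> up to an error that Cauchy--Schwarz bounds by a multiple of
  \<open>c\<^sup>2\<close> times the square root of the normalised energy of \<open>B\<^sub>i\<close>. If all these energies were below
  a small multiple of \<open>(\<delta> / K)\<^sup>2\<close>, each of the at least \<open>\<delta> log\<^sub>4 N\<close> blocks of size at least
  \<open>N powr (1 - \<delta>) / 4\<close> would contribute \<open>c / 2\<close>, which exceeds \<open>K ln N\<close> in total.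
\<close>

section \<open>Means over the unit circle and the mean value property\<close>

text \<open>Integration against normalised arc length, for functions of \<open>z\<close> rather than
  of the angle, so that holomorphy in \<open>z\<close> can be used directly.\<close>

definition circle_mean :: "(complex \<Rightarrow> 'a) \<Rightarrow> 'a::banach" where
  "circle_mean f = integral {0..1} (\<lambda>\<theta>. f (cis (2 * pi * \<theta>)))"

lemma integrable_on_circle:
  fixes f :: "complex \<Rightarrow> 'a::banach"
  assumes "continuous_on (sphere 0 1) f"
  shows "(\<lambda>\<theta>. f (cis (2 * pi * \<theta>))) integrable_on {0..1}"
proof (rule integrable_continuous_interval)
  show "continuous_on {0..1} (\<lambda>\<theta>. f (cis (2 * pi * \<theta>)))"
    by (rule continuous_on_compose2[OF assms]) (auto intro!: continuous_intros)
qed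

lemma circle_mean_cong:
  assumes "\<And>z. cmod z = 1 \<Longrightarrow> f z = g z"
  shows "circle_mean f = circle_mean g"
  unfolding circle_mean_def by (intro integral_cong) (simp add: assms)

lemma circle_mean_const [simp]: "circle_mean (\<lambda>_. c) = c"
  by (simp add: circle_mean_def)

lemma circle_mean_add:
  assumes "continuous_on (sphere 0 1) f" "continuous_on (sphere 0 1) g"
  shows "circle_mean (\<lambda>z. f z + g z) = circle_mean f + circle_mean g"
  unfolding circle_mean_def by (intro integral_add integrable_on_circle assms)

lemma circle_mean_diff:
  assumes "continuous_on (sphere 0 1) f" "continuous_on (sphere 0 1) g"
  shows "circle_mean (\<lambda>z. f z - g z) = circle_mean f - circle_mean g"
  unfolding circle_mean_def by (intro integral_diff integrable_on_circle assms)

lemma circle_mean_sum: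
  assumes "finite I" "\<And>i. i \<in> I \<Longrightarrow> continuous_on (sphere 0 1) (f i)"
  shows "circle_mean (\<lambda>z. \<Sum>i\<in>I. f i z) = (\<Sum>i\<in>I. circle_mean (f i))"
  unfolding circle_mean_def by (intro integral_sum integrable_on_circle assms)

lemma circle_mean_mult_left:
  fixes f :: "complex \<Rightarrow> 'a::{real_normed_field, banach}"
  assumes "continuous_on (sphere 0 1) f"
  shows "circle_mean (\<lambda>z. c * f z) = c * circle_mean f"
  unfolding circle_mean_def
  using integral_linear[OF integrable_on_circle[OF assms] bounded_linear_mult_right[of c]]
  by (simp add: o_def)

lemma Re_circle_mean:
  assumes "continuous_on (sphere 0 1) f"
  shows "Re (circle_mean f) = circle_mean (\<lambda>z. Re (f z))"
  unfolding circle_mean_def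
  using integral_linear[OF integrable_on_circle[OF assms] bounded_linear_Re]
  by (simp add: o_def)

lemma circle_mean_cnj: "circle_mean (\<lambda>z. cnj (f z)) = cnj (circle_mean f)"
  unfolding circle_mean_def by (simp add: integral_cnj)

lemma circle_mean_mono:
  fixes f g :: "complex \<Rightarrow> real"
  assumes "continuous_on (sphere 0 1) f" "continuous_on (sphere 0 1) g"
    and "\<And>z. cmod z = 1 \<Longrightarrow> f z \<le> g z"
  shows "circle_mean f \<le> circle_mean g"
  unfolding circle_mean_def
  by (intro integral_le integrable_on_circle assms) (simp add: assms)

lemma norm_circle_mean_le:
  assumes "continuous_on (sphere 0 1) f" "continuous_on (sphere 0 1) g"
    and "\<And>z. cmod z = 1 \<Longrightarrow> norm (f z) \<le> g z"
  shows "norm (circle_mean f) \<le> circle_mean g"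
  unfolding circle_mean_def
  by (intro integral_norm_bound_integral integrable_on_circle assms) (simp add: assms)

text \<open>This is Cauchy's integral formula at the centre of the disc.\<close>

lemma circle_mean_holomorphic:
  assumes "f holomorphic_on UNIV"
  shows "circle_mean f = f 0"
proof -
  have "((\<lambda>u. f u / (u - 0)) has_contour_integral (2 * of_real pi * \<i> * f 0)) (circlepath 0 1)"
    by (rule Cauchy_integral_circlepath_simple) (use assms holomorphic_on_subset in auto)
  \<comment> \<open>Along the circle \<open>du = 2 * pi * \<i> * u dx\<close>, which cancels the
    division by \<open>u\<close>.\<close>
  then have "((\<lambda>x. f (cis (2 * pi * x)) * (2 * of_real pi * \<i>))
      has_integral (2 * of_real pi * \<i> * f 0)) {0..1}"
    unfolding has_contour_integral vector_derivative_circlepath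
    by (rule has_integral_eq[rotated]) (auto simp: circlepath cis_conv_exp mult_ac)
  from has_integral_mult_left[OF this, of "inverse (2 * of_real pi * \<i>)"]
  have "((\<lambda>x. f (cis (2 * pi * x))) has_integral f 0) {0..1}"
    by (simp add: field_simps)
  then show ?thesis
    unfolding circle_mean_def by (rule integral_unique)
qed

lemma continuous_on_power_int_circle [continuous_intros]:
  "continuous_on (sphere 0 1) (\<lambda>z::complex. z powi n)"
  by (intro continuous_intros) auto

text \<open>The product is entire and vanishes at 0. This is how nonnegative frequencies are
  exploited: a positive shift of them leaves no constant term.\<close>

lemma circle_mean_power_int_mult:
  assumes "f holomorphic_on UNIV" "n > 0"
  shows "circle_mean (\<lambda>z. z powi n * f z) = 0"
proof -
  have "circle_mean (\<lambda>z. z ^ nat n * f z) = 0"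
    using assms by (subst circle_mean_holomorphic) (auto intro!: holomorphic_intros)
  then show ?thesis
    using assms by (simp add: power_int_def)
qed

lemma cnj_power_int_circle: "cmod z = 1 \<Longrightarrow> cnj (z powi n) = z powi (- n)"
proof -
  assume z: "cmod z = 1"
  have "z * cnj z = 1" using z by (simp add: complex_norm_square[symmetric])
  then have "cnj z = inverse z"
    by (metis inverse_unique)
  then show ?thesis by (simp add: power_int_minus power_int_inverse)
qed

text \<open>Orthogonality of characters; conjugation reduces negative exponents to positive
  ones.\<close>

lemma circle_mean_power_int: "circle_mean (\<lambda>z. z powi n) = (if n = 0 then 1 else 0)"
proof -
  have pos: "circle_mean (\<lambda>z. z powi m) = 0" if "m > 0" for m
    using circle_mean_power_int_mult[of "\<lambda>_. 1" m] that by simp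
  consider "n = 0" | "n > 0" | "n < 0" by linarith
  then show ?thesis
  proof cases
    case 3
    have "circle_mean (\<lambda>z. z powi n) = circle_mean (\<lambda>z. cnj (z powi (- n)))"
      by (rule circle_mean_cong) (simp only: cnj_power_int_circle, simp)
    also have "\<dots> = 0"
      using pos[of "- n"] 3 by (simp only: circle_mean_cnj) simp
    finally show ?thesis using 3 by simp
  qed (use pos in auto)
qed

text \<open>The mean of \<open>(f z)\<^sup>2\<close> is \<open>(f 0)\<^sup>2\<close>, which is real
  and nonnegative. Its real part compares the means of \<open>(Re (f z))\<^sup>2\<close> and
  \<open>(Im (f z))\<^sup>2\<close>, so control of the real part is enough.\<close>

lemma circle_mean_norm_sq_holomorphic_le:
  assumes "f holomorphic_on UNIV" "Im (f 0) = 0"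
  shows "circle_mean (\<lambda>z. (cmod (f z))\<^sup>2) \<le> 2 * circle_mean (\<lambda>z. (Re (f z))\<^sup>2)"
proof -
  have cont: "continuous_on (sphere 0 1) f"
    using assms(1) holomorphic_on_imp_continuous_on holomorphic_on_subset by blast
  have "circle_mean (\<lambda>z. (f z)\<^sup>2) = (f 0)\<^sup>2"
    by (rule circle_mean_holomorphic) (intro holomorphic_intros assms)
  then have "Re ((f 0)\<^sup>2) = circle_mean (\<lambda>z. Re ((f z)\<^sup>2))"
    using Re_circle_mean[of "\<lambda>z. (f z)\<^sup>2"] continuous_on_power[OF cont] by simp
  moreover have "0 \<le> Re ((f 0)\<^sup>2)"
    using assms(2) by (simp add: power2_eq_square)
  ultimately have "0 \<le> circle_mean (\<lambda>z. (Re (f z))\<^sup>2 - (Im (f z))\<^sup>2)"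
    by (simp add: power2_eq_square)
  also have "\<dots> = circle_mean (\<lambda>z. (Re (f z))\<^sup>2) - circle_mean (\<lambda>z. (Im (f z))\<^sup>2)"
    by (intro circle_mean_diff continuous_intros cont)
  finally have "circle_mean (\<lambda>z. (Im (f z))\<^sup>2) \<le> circle_mean (\<lambda>z. (Re (f z))\<^sup>2)" by simp
  moreover have "circle_mean (\<lambda>z. (cmod (f z))\<^sup>2)
      = circle_mean (\<lambda>z. (Re (f z))\<^sup>2) + circle_mean (\<lambda>z. (Im (f z))\<^sup>2)"
    unfolding cmod_power2 by (intro circle_mean_add continuous_intros cont)
  ultimately show ?thesis by simp
qed

section \<open>Exponential sums and their second and fourth moments\<close>

definition trig_sum :: "int set \<Rightarrow> complex \<Rightarrow> complex" where
  "trig_sum B z = (\<Sum>b\<in>B. z powi b)"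

lemma continuous_on_trig_sum [continuous_intros]: "continuous_on (sphere 0 1) (trig_sum B)"
  unfolding trig_sum_def by (intro continuous_intros) auto

lemma cnj_trig_sum: "cmod z = 1 \<Longrightarrow> cnj (trig_sum B z) = (\<Sum>b\<in>B. z powi (- b))"
  by (simp add: trig_sum_def cnj_power_int_circle del: complex_cnj_power_int)

text \<open>The conjugate comes from the minus sign in the Fourier exponent; it does not affect the
  modulus.\<close>

lemma fourier_ind_eq_cnj_trig_sum: "fourier_ind A \<theta> = cnj (trig_sum A (cis (2 * pi * \<theta>)))"
  unfolding cnj_trig_sum[OF norm_cis] fourier_ind_def cis_power_int
  by (simp add: cis_conv_exp mult_ac)

lemma fourier_ind_L1_eq: "fourier_ind_L1 A = circle_mean (\<lambda>z. cmod (trig_sum A z))"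
  by (simp add: fourier_ind_L1_def circle_mean_def fourier_ind_eq_cnj_trig_sum)

lemma circle_mean_of_real:
  fixes f :: "complex \<Rightarrow> real"
  assumes "continuous_on (sphere 0 1) f"
  shows "circle_mean (\<lambda>z. complex_of_real (f z)) = of_real (circle_mean f)"
  unfolding circle_mean_def
  using integral_linear[OF integrable_on_circle[OF assms] bounded_linear_of_real]
  by (simp add: o_def)

text \<open>Parseval: after expanding the square, only the diagonal terms have nonzero mean.\<close>

lemma circle_mean_norm_sq_trig_sum:
  assumes "finite B"
  shows "circle_mean (\<lambda>z. (cmod (trig_sum B z))\<^sup>2) = card B"
proof -
  have "circle_mean (\<lambda>z. complex_of_real ((cmod (trig_sum B z))\<^sup>2))
      = circle_mean (\<lambda>z. \<Sum>b\<in>B. \<Sum>c\<in>B. z powi (b - c))"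
  proof (rule circle_mean_cong)
    fix z :: complex assume z: "cmod z = 1"
    then have [simp]: "z \<noteq> 0" by auto
    show "complex_of_real ((cmod (trig_sum B z))\<^sup>2) = (\<Sum>b\<in>B. \<Sum>c\<in>B. z powi (b - c))"
      unfolding complex_norm_square cnj_trig_sum[OF z]
      by (simp add: trig_sum_def sum_product power_int_diff power_int_minus divide_inverse)
  qed
  also have "\<dots> = (\<Sum>b\<in>B. \<Sum>c\<in>B. if b = c then 1 else 0)"
    by (simp add: circle_mean_sum circle_mean_power_int assms continuous_intros)
  also have "\<dots> = of_nat (card B)"
    using assms by simp
  finally have "complex_of_real (circle_mean (\<lambda>z. (cmod (trig_sum B z))\<^sup>2)) = of_real (card B)"
    by (subst circle_mean_of_real[symmetric]) (auto intro!: continuous_intros)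
  then show ?thesis by (simp only: of_real_eq_iff)
qed

text \<open>Expanding the fourth power gives one character for each quadruple, and orthogonality
  keeps exactly the additive quadruples.\<close>

lemma circle_mean_norm_pow4_trig_sum:
  assumes "finite B"
  shows "circle_mean (\<lambda>z. (cmod (trig_sum B z)) ^ 4) = additive_energy B"
proof -
  let ?Q = "B \<times> B \<times> B \<times> B"
  have "circle_mean (\<lambda>z. complex_of_real ((cmod (trig_sum B z)) ^ 4))
      = circle_mean (\<lambda>z. \<Sum>(b1, b2, b3, b4)\<in>?Q. z powi (b1 + b2 - (b3 + b4)))"
  proof (rule circle_mean_cong)
    fix z :: complex assume z: "cmod z = 1"
    then have nz: "z \<noteq> 0" by auto
    have "complex_of_real ((cmod (trig_sum B z)) ^ 4)
        = (complex_of_real ((cmod (trig_sum B z))\<^sup>2))\<^sup>2"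
      by (simp flip: power_mult)
    also have "\<dots> = trig_sum B z * (trig_sum B z * (cnj (trig_sum B z) * cnj (trig_sum B z)))"
      unfolding complex_norm_square by (simp add: power2_eq_square mult_ac)
    also have "\<dots> = (\<Sum>(b1, b2, b3, b4)\<in>?Q. z powi (b1 + b2 - (b3 + b4)))"
      unfolding cnj_trig_sum[OF z] unfolding trig_sum_def sum_product sum.cartesian_product
      by (rule sum.cong)
         (auto simp: nz power_int_diff power_int_add power_int_minus divide_inverse mult_ac)
    finally show "complex_of_real ((cmod (trig_sum B z)) ^ 4)
        = (\<Sum>(b1, b2, b3, b4)\<in>?Q. z powi (b1 + b2 - (b3 + b4)))" .
  qed
  also have "\<dots> = (\<Sum>(b1, b2, b3, b4)\<in>?Q. if b1 + b2 = b3 + b4 then 1 else 0)"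
    using assms
    by (simp add: case_prod_unfold circle_mean_sum circle_mean_power_int continuous_intros)
  also have "\<dots> = (\<Sum>q\<in>?Q. if q \<in> {(b1, b2, b3, b4). b1 + b2 = b3 + b4} then 1 else 0)"
    by (rule sum.cong) auto
  also have "\<dots> = of_nat (card (?Q \<inter> {(b1, b2, b3, b4). b1 + b2 = b3 + b4}))"
    using assms by (subst sum.inter_restrict[symmetric]) auto
  also have "?Q \<inter> {(b1, b2, b3, b4). b1 + b2 = b3 + b4} =
      {(b1, b2, b3, b4). b1 \<in> B \<and> b2 \<in> B \<and> b3 \<in> B \<and> b4 \<in> B \<and> b1 + b2 = b3 + b4}"
    by auto
  finally have "complex_of_real (circle_mean (\<lambda>z. (cmod (trig_sum B z)) ^ 4))
      = of_real (additive_energy B)"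
    by (subst circle_mean_of_real[symmetric])
       (auto intro!: continuous_intros simp: additive_energy_def)
  then show ?thesis by (simp only: of_real_eq_iff)
qed

section \<open>Polynomials whose real part majorises a given function on the circle\<close>

text \<open>On the circle \<open>z * cnj z = 1\<close>, so the product of the two non-constant parts
  loses a factor \<open>z\<close> on each side and the induction hypothesis applies to it.\<close>

lemma Re_mult_cnj_poly_on_circle:
  "\<exists>r. \<forall>z. cmod z = 1 \<longrightarrow> Re (poly p z * cnj (poly q z)) = Re (poly r z)"
proof (induction p arbitrary: q)
  case 0
  then show ?case by (intro exI[of _ 0]) simp
next
  case (pCons a p)
  obtain b q' where q: "q = pCons b q'" by (cases q)
  obtain r where r: "\<And>z. cmod z = 1 \<Longrightarrow> Re (poly p z * cnj (poly q' z)) = Re (poly r z)"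
    using pCons.IH by blast
  show ?case
  proof (intro exI allI impI)
    fix z :: complex assume z: "cmod z = 1"
    then have "z * cnj z = 1" by (simp add: complex_norm_square[symmetric])
    then have "poly (pCons a p) z * cnj (poly q z) =
        a * cnj (poly q z) + cnj b * (z * poly p z) + poly p z * cnj (poly q' z)"
      unfolding q by (simp add: algebra_simps)
    \<comment> \<open>Conjugating the first summand turns it into a polynomial and keeps its real
      part.\<close>
    also have "Re \<dots> = Re (cnj a * poly q z + cnj b * (z * poly p z) + poly r z)"
      using r[OF z] by (simp add: algebra_simps)
    also have "cnj a * poly q z + cnj b * (z * poly p z) + poly r z =
        poly (smult (cnj a) q + smult (cnj b) (pCons 0 p) + r) z"
      by simp
    finally show "Re (poly (pCons a p) z * cnj (poly q z)) =
        Re (poly (smult (cnj a) q + smult (cnj b) (pCons 0 p) + r) z)" .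
  qed
qed

text \<open>Since \<open>2 * Re u * Re v = Re (u * v) + Re (u * cnj v)\<close>, real parts of
  polynomials form an algebra on the circle, as Stone-Weierstrass requires.\<close>

lemma Re_poly_mult_on_circle:
  "\<exists>r. \<forall>z. cmod z = 1 \<longrightarrow> Re (poly p z) * Re (poly q z) = Re (poly r z)"
proof -
  obtain r where r: "\<And>z. cmod z = 1 \<Longrightarrow> Re (poly p z * cnj (poly q z)) = Re (poly r z)"
    using Re_mult_cnj_poly_on_circle by blast
  have "Re (poly p z) * Re (poly q z) = Re (poly (smult (1/2) (p * q + r)) z)"
    if "cmod z = 1" for z
    using r[OF that] by simp
  then show ?thesis by blast
qed

lemma circle_approx_Re_poly:
  fixes f :: "complex \<Rightarrow> real"
  assumes "continuous_on (sphere 0 1) f" "\<epsilon> > 0"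
  shows "\<exists>p. \<forall>z. cmod z = 1 \<longrightarrow> \<bar>f z - Re (poly p z)\<bar> < \<epsilon>"
proof -
  let ?R = "{h :: complex \<Rightarrow> real. \<exists>p. \<forall>z\<in>sphere 0 1. h z = Re (poly p z)}"
  interpret function_ring_on ?R "sphere 0 1"
  proof
    fix h assume "h \<in> ?R"
    then obtain p where "\<forall>z\<in>sphere 0 1. h z = Re (poly p z)" by blast
    then show "continuous_on (sphere 0 1) h"
      by (subst continuous_on_cong[OF refl]) (auto intro!: continuous_intros)
  next
    fix g h assume "g \<in> ?R" "h \<in> ?R"
    then obtain p q where pq: "\<forall>z\<in>sphere 0 1. g z = Re (poly p z)"
      "\<forall>z\<in>sphere 0 1. h z = Re (poly q z)" by blast
    then show "(\<lambda>x. g x + h x) \<in> ?R"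
      by (auto intro!: exI[of _ "p + q"])
    show "(\<lambda>x. g x * h x) \<in> ?R"
      using Re_poly_mult_on_circle[of p q] pq by auto
  next
    fix c :: real
    show "(\<lambda>_. c) \<in> ?R"
      by (auto intro!: exI[of _ "[:of_real c:]"])
  next
    fix x y :: complex assume "x \<noteq> y"
    then consider "Re x \<noteq> Re y" | "Im x \<noteq> Im y"
      using complex_eq_iff by blast
    then show "\<exists>f\<in>?R. f x \<noteq> f y"
    proof cases
      case 1
      then show ?thesis
        by (intro bexI[of _ Re]) (auto intro!: exI[of _ "[:0, 1:]"])
    next
      case 2
      \<comment> \<open>\<open>Im z\<close> is the real part of \<open>- \<i> * z\<close>.\<close>
      then show ?thesis
        by (intro bexI[of _ Im]) (auto intro!: exI[of _ "[:0, - \<i>:]"])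
    qed
  qed auto
  obtain h p where "\<forall>x\<in>sphere 0 1. \<bar>f x - h x\<bar> < \<epsilon>" "\<forall>z\<in>sphere 0 1. h z = Re (poly p z)"
    using Stone_Weierstrass_basic[OF assms] by blast
  then show ?thesis by (intro exI[of _ p]) simp
qed

text \<open>A real shift by \<open>\<epsilon> / 2\<close> turns a uniform approximation into a
  majorant. Subtracting an imaginary constant makes the value at 0 real without changing real
  parts.\<close>

lemma exists_holomorphic_majorant:
  fixes f :: "complex \<Rightarrow> real"
  assumes "continuous_on (sphere 0 1) f" "\<epsilon> > 0"
  obtains \<phi> where "\<phi> holomorphic_on UNIV" "Im (\<phi> 0) = 0"
    "\<And>z. cmod z = 1 \<Longrightarrow> f z \<le> Re (\<phi> z) \<and> Re (\<phi> z) \<le> f z + \<epsilon>"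
proof -
  obtain p where p: "\<And>z. cmod z = 1 \<Longrightarrow> \<bar>f z - Re (poly p z)\<bar> < \<epsilon> / 2"
    using circle_approx_Re_poly[OF assms(1), of "\<epsilon> / 2"] assms(2) by auto
  show thesis
  proof
    show "(\<lambda>z. poly p z + of_real (\<epsilon> / 2) - \<i> * Im (poly p 0)) holomorphic_on UNIV"
      by (intro holomorphic_intros)
  next
    fix z :: complex assume "cmod z = 1"
    then have "\<bar>f z - Re (poly p z)\<bar> < \<epsilon> / 2" by (rule p)
    then have "f z - Re (poly p z) < \<epsilon> / 2" "Re (poly p z) - f z < \<epsilon> / 2"
      by linarith+
    then show "f z \<le> Re (poly p z + of_real (\<epsilon> / 2) - \<i> * Im (poly p 0)) \<and>
          Re (poly p z + of_real (\<epsilon> / 2) - \<i> * Im (poly p 0)) \<le> f z + \<epsilon>"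
      by simp
  qed auto
qed

text \<open>The majorised function has L^2 norm \<open>c / sqrt m\<close> with
  \<open>m = card B\<close>, and the approximation error is allowed to be of that same size. This
  bounds the mean of \<open>(Re (\<phi> z))\<^sup>2\<close> by \<open>4 * c\<^sup>2 / m\<close>; the
  imaginary part at most doubles it.\<close>

lemma exists_holomorphic_majorant_trig_sum:
  assumes "finite B" "B \<noteq> {}" "c > 0"
  obtains \<phi> where "\<phi> holomorphic_on UNIV"
    "\<And>z. cmod z = 1 \<Longrightarrow> c / card B * cmod (trig_sum B z) \<le> Re (\<phi> z)"
    "circle_mean (\<lambda>z. (cmod (\<phi> z))\<^sup>2) \<le> 8 * c\<^sup>2 / card B"
proof -
  define m where "m = real (card B)"
  have m: "m > 0" using assms by (simp add: m_def card_gt_0_iff)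
  have "continuous_on (sphere 0 1) (\<lambda>z. c / m * cmod (trig_sum B z))"
    by (intro continuous_intros)
  moreover have "c / sqrt m > 0" using assms m by simp
  ultimately obtain \<phi> where \<phi>: "\<phi> holomorphic_on UNIV" "Im (\<phi> 0) = 0"
    "\<And>z. cmod z = 1 \<Longrightarrow> c / m * cmod (trig_sum B z) \<le> Re (\<phi> z) \<and>
      Re (\<phi> z) \<le> c / m * cmod (trig_sum B z) + c / sqrt m"
    using exists_holomorphic_majorant by blast
  have cont: "continuous_on (sphere 0 1) \<phi>"
    using \<phi>(1) holomorphic_on_imp_continuous_on holomorphic_on_subset by blast
  have "circle_mean (\<lambda>z. (Re (\<phi> z))\<^sup>2)
      \<le> circle_mean (\<lambda>z. 2 * (c / m)\<^sup>2 * (cmod (trig_sum B z))\<^sup>2 + 2 * c\<^sup>2 / m)"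
  proof (rule circle_mean_mono)
    fix z :: complex assume z: "cmod z = 1"
    define g where "g = c / m * cmod (trig_sum B z)"
    have "g \<ge> 0" using assms m by (simp add: g_def)
    then have "(Re (\<phi> z))\<^sup>2 \<le> (g + c / sqrt m)\<^sup>2"
      using \<phi>(3)[OF z] by (intro power_mono) (auto simp: g_def)
    also have "\<dots> \<le> 2 * g\<^sup>2 + 2 * (c / sqrt m)\<^sup>2"
      using zero_le_power2[of "g - c / sqrt m"] by (simp add: power2_sum power2_diff)
    finally show "(Re (\<phi> z))\<^sup>2 \<le> 2 * (c / m)\<^sup>2 * (cmod (trig_sum B z))\<^sup>2 + 2 * c\<^sup>2 / m"
      using m by (simp add: g_def power_mult_distrib power_divide)
  qed (intro continuous_intros cont)+
  also have "\<dots> = 2 * (c / m)\<^sup>2 * m + 2 * c\<^sup>2 / m"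
    using assms
    by (simp add: circle_mean_add circle_mean_mult_left continuous_intros
        circle_mean_norm_sq_trig_sum m_def)
  also have "\<dots> = 4 * c\<^sup>2 / m"
    using m by (simp add: field_simps power2_eq_square)
  finally have "circle_mean (\<lambda>z. (cmod (\<phi> z))\<^sup>2) \<le> 8 * c\<^sup>2 / m"
    using circle_mean_norm_sq_holomorphic_le[OF \<phi>(1,2)] by simp
  with \<phi> that show thesis by (auto simp: m_def)
qed

section \<open>Exponential damping\<close>

text \<open>Mean value inequality on the left half-plane, where \<open>exp\<close> has modulus at
  most 1.\<close>

lemma norm_exp_minus_diff_one_le:
  assumes "Re w \<ge> 0"
  shows "cmod (exp (- w) - 1) \<le> cmod w"
proof -
  have "cmod (exp (- w) - exp 0) \<le> 1 * cmod (- w - 0)"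
  proof (rule field_differentiable_bound[where S = "{z. Re z \<le> 0}" and f' = exp])
    show "(exp has_field_derivative exp z) (at z within {z. Re z \<le> 0})" for z :: complex
      by (auto intro!: derivative_eq_intros)
  qed (use assms in \<open>auto simp: convex_halfspace_Re_le\<close>)
  then show ?thesis by simp
qed

text \<open>Raising \<open>q\<close> by one sends the sum \<open>S\<close> to
  \<open>(S + g q) * exp (- h q)\<close>. With \<open>x = Re (h q)\<close> its modulus is at most
  \<open>(1 + x) * exp (- x)\<close>, hence at most 1.\<close>

lemma norm_damped_sum_le_one:
  fixes g h :: "nat \<Rightarrow> complex"
  assumes "\<And>k. k \<in> {p..<q} \<Longrightarrow> cmod (g k) \<le> Re (h k)"
  shows "cmod (\<Sum>i\<in>{p..<q}. g i * exp (- (\<Sum>k\<in>{i..<q}. h k))) \<le> 1"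
  using assms
proof (induction q)
  case (Suc q)
  show ?case
  proof (cases "p \<le> q")
    case True
    define S where "S = (\<Sum>i\<in>{p..<q}. g i * exp (- (\<Sum>k\<in>{i..<q}. h k)))"
    have S: "cmod S \<le> 1" unfolding S_def using Suc by auto
    have "(\<Sum>i\<in>{p..<Suc q}. g i * exp (- (\<Sum>k\<in>{i..<Suc q}. h k))) = (S + g q) * exp (- h q)"
    proof -
      have "exp (- (\<Sum>k\<in>{i..<Suc q}. h k)) = exp (- (\<Sum>k\<in>{i..<q}. h k)) * exp (- h q)"
        if "i \<le> q" for i
        using that by (simp add: mult_exp_exp)
      then have "(\<Sum>i\<in>{p..<q}. g i * exp (- (\<Sum>k\<in>{i..<Suc q}. h k))) = S * exp (- h q)"
        unfolding S_def sum_distrib_right by (intro sum.cong) (auto simp: mult.assoc)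
      then show ?thesis
        unfolding sum.atLeastLessThan_Suc[OF True] by (simp add: distrib_right)
    qed
    also have "cmod \<dots> \<le> (1 + Re (h q)) * exp (- Re (h q))"
    proof -
      have "cmod (S + g q) \<le> 1 + Re (h q)"
        using norm_triangle_ineq[of S "g q"] S Suc.prems[of q] True by simp
      then show ?thesis
        by (simp add: norm_mult)
    qed
    also have "\<dots> \<le> exp (Re (h q)) * exp (- Re (h q))"
      by (intro mult_right_mono) auto
    finally show ?thesis by (simp add: exp_minus)
  qed auto
qed auto

section \<open>Energy bounds and sets of largest elements\<close>

text \<open>Cauchy--Schwarz in the form
  \<open>x * y \<le> t / 2 * x\<^sup>2 + y\<^sup>2 / (2 * t)\<close>, with the weight
  \<open>t\<close> left free. The fourth moment brings in the energy.\<close>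

lemma circle_mean_trig_sum_sq_mult_le:
  assumes "finite B" "continuous_on (sphere 0 1) \<phi>" "t > 0"
  shows "circle_mean (\<lambda>z. (cmod (trig_sum B z))\<^sup>2 * cmod (\<phi> z))
    \<le> t / 2 * additive_energy B + circle_mean (\<lambda>z. (cmod (\<phi> z))\<^sup>2) / (2 * t)"
proof -
  have "circle_mean (\<lambda>z. (cmod (trig_sum B z))\<^sup>2 * cmod (\<phi> z))
    \<le> circle_mean (\<lambda>z. t / 2 * (cmod (trig_sum B z)) ^ 4 + inverse (2 * t) * (cmod (\<phi> z))\<^sup>2)"
  proof (rule circle_mean_mono)
    fix z :: complex
    define x y where "x = (cmod (trig_sum B z))\<^sup>2" and "y = cmod (\<phi> z)"
    have "0 \<le> (t * x - y)\<^sup>2 / (2 * t)" using assms by simp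
    also have "\<dots> = t / 2 * x\<^sup>2 + inverse (2 * t) * y\<^sup>2 - x * y"
      using assms(3) by (simp add: field_simps power2_eq_square)
    finally show "(cmod (trig_sum B z))\<^sup>2 * cmod (\<phi> z)
        \<le> t / 2 * (cmod (trig_sum B z)) ^ 4 + inverse (2 * t) * (cmod (\<phi> z))\<^sup>2"
      by (simp add: x_def y_def flip: power_mult)
  qed (intro continuous_intros assms)+
  also have "\<dots> = circle_mean (\<lambda>z. t / 2 * (cmod (trig_sum B z)) ^ 4)
      + circle_mean (\<lambda>z. inverse (2 * t) * (cmod (\<phi> z))\<^sup>2)"
    by (intro circle_mean_add continuous_intros assms)
  also have "circle_mean (\<lambda>z. t / 2 * (cmod (trig_sum B z)) ^ 4) = t / 2 * additive_energy B"
    unfolding circle_mean_norm_pow4_trig_sum[OF assms(1), symmetric]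
    by (intro circle_mean_mult_left continuous_intros)
  also have "circle_mean (\<lambda>z. inverse (2 * t) * (cmod (\<phi> z))\<^sup>2)
      = inverse (2 * t) * circle_mean (\<lambda>z. (cmod (\<phi> z))\<^sup>2)"
    by (intro circle_mean_mult_left continuous_intros assms)
  also have "\<dots> = circle_mean (\<lambda>z. (cmod (\<phi> z))\<^sup>2) / (2 * t)"
    by (simp only: divide_inverse mult.commute)
  finally show ?thesis .
qed

text \<open>Every \<open>a\<close> in \<open>A - B\<close> and \<open>b\<close> in \<open>B\<close>
  give a positive exponent \<open>b - a\<close>, so the corresponding term, multiplied by the entire
  function \<open>f\<close>, has mean 0.\<close>

lemma circle_mean_top_subset:
  assumes "finite A" "B \<subseteq> A" "\<And>a b. a \<in> A - B \<Longrightarrow> b \<in> B \<Longrightarrow> a < b" "f holomorphic_on UNIV"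
  shows "circle_mean (\<lambda>z. trig_sum B z * f z * cnj (trig_sum A z))
       = circle_mean (\<lambda>z. of_real ((cmod (trig_sum B z))\<^sup>2) * f z)"
proof -
  have B: "finite B" using assms finite_subset by blast
  have cont: "continuous_on (sphere 0 1) f"
    using assms(4) holomorphic_on_imp_continuous_on holomorphic_on_subset by blast
  have "circle_mean (\<lambda>z. trig_sum B z * f z * cnj (trig_sum A z))
      - circle_mean (\<lambda>z. of_real ((cmod (trig_sum B z))\<^sup>2) * f z)
      = circle_mean (\<lambda>z. trig_sum B z * f z * cnj (trig_sum A z)
          - of_real ((cmod (trig_sum B z))\<^sup>2) * f z)"
    by (intro circle_mean_diff[symmetric] continuous_intros cont)
  also have "\<dots> = circle_mean (\<lambda>z. \<Sum>b\<in>B. \<Sum>a\<in>A - B. z powi (b - a) * f z)"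
  proof (rule circle_mean_cong)
    fix z :: complex assume z: "cmod z = 1"
    then have nz: "z \<noteq> 0" by auto
    have "trig_sum A z = trig_sum B z + trig_sum (A - B) z"
      unfolding trig_sum_def using assms sum.subset_diff[of B A] by (simp add: add.commute)
    then have "trig_sum B z * f z * cnj (trig_sum A z)
          - of_real ((cmod (trig_sum B z))\<^sup>2) * f z
        = trig_sum B z * cnj (trig_sum (A - B) z) * f z"
      unfolding complex_norm_square by (simp add: algebra_simps)
    also have "\<dots> = (\<Sum>b\<in>B. \<Sum>a\<in>A - B. z powi (b - a) * f z)"
      unfolding cnj_trig_sum[OF z]
      unfolding trig_sum_def sum_product unfolding sum_distrib_right
      by (intro sum.cong refl) (simp add: power_int_diff power_int_minus nz divide_inverse)
    finally show "trig_sum B z * f z * cnj (trig_sum A z)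
          - of_real ((cmod (trig_sum B z))\<^sup>2) * f z
        = (\<Sum>b\<in>B. \<Sum>a\<in>A - B. z powi (b - a) * f z)" .
  qed
  also have "\<dots> = 0"
    using assms B
    by (simp add: circle_mean_sum circle_mean_power_int_mult continuous_intros cont)
  finally show ?thesis by simp
qed

text \<open>The set grows by the maximum of its complement in \<open>A\<close>.\<close>

lemma exists_top_subset:
  fixes A :: "'a::linorder set"
  assumes "finite A" "m \<le> card A"
  shows "\<exists>B\<subseteq>A. card B = m \<and> (\<forall>a\<in>A - B. \<forall>b\<in>B. a < b)"
  using assms(2)
proof (induction m)
  case 0
  show ?case by (intro exI[of _ "{}"]) auto
next
  case (Suc m)
  then obtain B where B: "B \<subseteq> A" "card B = m" "\<forall>a\<in>A - B. \<forall>b\<in>B. a < b" by auto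
  have fin: "finite B" using B assms finite_subset by blast
  have "card (A - B) \<noteq> 0"
    using B Suc fin by (simp add: card_Diff_subset)
  then have ne: "A - B \<noteq> {}" by (metis card.empty)
  define x where "x = Max (A - B)"
  have x: "x \<in> A - B" "\<And>a. a \<in> A - B \<Longrightarrow> a \<le> x"
    using assms ne Max_in[of "A - B"] by (auto simp: x_def)
  show ?case
  proof (intro exI conjI)
    show "card (insert x B) = Suc m" using x fin B by simp
    show "\<forall>a\<in>A - insert x B. \<forall>b\<in>insert x B. a < b"
      using x B by (auto simp: less_le)
  qed (use x B in auto)
qed

lemma sum_inverse_power_two_le: "(\<Sum>k\<in>{i..<q}. 1 / 2 ^ k) \<le> (2 / 2 ^ i :: real)"
proof (cases "i \<le> q")
  case True
  then have "(\<Sum>k\<in>{i..<q}. 1 / 2 ^ k) = (2 / 2 ^ i - 2 / 2 ^ q :: real)"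
    by (induction q rule: dec_induct) auto
  then show ?thesis by simp
qed auto

section \<open>The lower bound for the L^1 norm\<close>

text \<open>Each block adds at least \<open>c / 2\<close> to the pairing with the test function
  \<open>F\<close>. As \<open>64 ^ i\<close> is the cube of the block size,
  \<open>\<kappa>\<^sup>2\<close> bounds the normalised energies.\<close>

lemma fourier_ind_L1_ge_of_small_energy:
  assumes A: "finite A"
    and sub: "\<And>i. i \<in> {p..<q} \<Longrightarrow> B i \<subseteq> A"
    and card: "\<And>i. i \<in> {p..<q} \<Longrightarrow> card (B i) = 4 ^ i"
    and top: "\<And>i a b. i \<in> {p..<q} \<Longrightarrow> a \<in> A - B i \<Longrightarrow> b \<in> B i \<Longrightarrow> a < b"
    and energy: "\<And>i. i \<in> {p..<q} \<Longrightarrow> real (additive_energy (B i)) \<le> \<kappa>\<^sup>2 * 64 ^ i"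
    and c: "c > 0" and \<kappa>: "\<kappa> > 0" and c\<kappa>: "18 * c * \<kappa> \<le> 1"
  shows "real (q - p) * (c / 2) \<le> fourier_ind_L1 A"
proof -
  have fin: "finite (B i)" if "i \<in> {p..<q}" for i
    using sub[OF that] A finite_subset by blast
  have "\<exists>\<phi>. \<phi> holomorphic_on UNIV \<and>
      (\<forall>z. cmod z = 1 \<longrightarrow> c / 4 ^ i * cmod (trig_sum (B i) z) \<le> Re (\<phi> z)) \<and>
      circle_mean (\<lambda>z. (cmod (\<phi> z))\<^sup>2) \<le> 8 * c\<^sup>2 / 4 ^ i" if i: "i \<in> {p..<q}" for i
  proof -
    have "B i \<noteq> {}" using card[OF i] by auto
    from exists_holomorphic_majorant_trig_sum[OF fin[OF i] this c]
    show ?thesis unfolding card[OF i] by auto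
  qed
  then obtain \<phi> where
    hol: "\<And>i. i \<in> {p..<q} \<Longrightarrow> \<phi> i holomorphic_on UNIV" and
    maj: "\<And>i z. i \<in> {p..<q} \<Longrightarrow> cmod z = 1 \<Longrightarrow>
      c / 4 ^ i * cmod (trig_sum (B i) z) \<le> Re (\<phi> i z)" and
    sq: "\<And>i. i \<in> {p..<q} \<Longrightarrow> circle_mean (\<lambda>z. (cmod (\<phi> i z))\<^sup>2) \<le> 8 * c\<^sup>2 / 4 ^ i"
    by metis
  have cont: "continuous_on (sphere 0 1) (\<phi> i)" if "i \<in> {p..<q}" for i
    using hol[OF that] holomorphic_on_imp_continuous_on holomorphic_on_subset by blast
  define g where "g i z = of_real (c / 4 ^ i) * trig_sum (B i) z" for i z
  define H where "H i z = (\<Sum>k\<in>{i..<q}. \<phi> k z)" for i z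
  define F where "F z = (\<Sum>i\<in>{p..<q}. g i z * exp (- H i z))" for z
  have norm_g: "cmod (g i z) \<le> Re (\<phi> i z)" if "i \<in> {p..<q}" "cmod z = 1" for i z
    using maj[OF that] c by (simp add: g_def norm_mult norm_divide norm_power)
  have H_hol: "H i holomorphic_on UNIV" if "i \<in> {p..<q}" for i
    unfolding H_def using that by (auto intro!: holomorphic_intros hol)
  have H_cont: "continuous_on (sphere 0 1) (H i)" if "i \<in> {p..<q}" for i
    using H_hol[OF that] holomorphic_on_imp_continuous_on holomorphic_on_subset by blast
  have g_cont: "continuous_on (sphere 0 1) (g i)" for i
    unfolding g_def by (intro continuous_intros)

  have block: "c / 2 \<le> Re (circle_mean (\<lambda>z. g i z * exp (- H i z) * cnj (trig_sum A z)))"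
    if i: "i \<in> {p..<q}" for i
  proof -
    let ?s = "\<lambda>z. (cmod (trig_sum (B i) z))\<^sup>2"
    \<comment> \<open>Without the damping factor this mean is exactly \<open>4 ^ i\<close> by
      Parseval. It suffices that damping costs at most half of it, since the block contributes
      \<open>c / 4 ^ i * Re X\<close>.\<close>
    define X where "X = circle_mean (\<lambda>z. of_real (?s z) * exp (- H i z))"
    note [continuous_intros] = H_cont[OF i]
    have "circle_mean (\<lambda>z. of_real (?s z) :: complex) = 4 ^ i"
      using circle_mean_norm_sq_trig_sum[OF fin[OF i]] card[OF i]
      by (subst circle_mean_of_real) (auto intro!: continuous_intros)
    then have "X - 4 ^ i = circle_mean (\<lambda>z. of_real (?s z) * exp (- H i z) - of_real (?s z))"
      unfolding X_def by (subst circle_mean_diff) (auto intro!: continuous_intros)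
    also have "cmod \<dots> \<le> circle_mean (\<lambda>z. \<Sum>k\<in>{i..<q}. ?s z * cmod (\<phi> k z))"
    proof (rule norm_circle_mean_le)
      fix z :: complex assume z: "cmod z = 1"
      \<comment> \<open>Each \<open>Re (\<phi> k z)\<close> majorises a modulus, so the half-plane
        estimate for \<open>exp\<close> applies.\<close>
      have "Re (H i z) \<ge> 0"
        unfolding H_def Re_sum using i norm_g z
        by (intro sum_nonneg) (metis atLeastLessThan_iff norm_ge_zero order_trans)
      then have "cmod (exp (- H i z) - 1) \<le> cmod (H i z)"
        by (rule norm_exp_minus_diff_one_le)
      also have "\<dots> \<le> (\<Sum>k\<in>{i..<q}. cmod (\<phi> k z))"
        unfolding H_def by (rule norm_sum)
      finally have "?s z * cmod (exp (- H i z) - 1) \<le> ?s z * (\<Sum>k\<in>{i..<q}. cmod (\<phi> k z))"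
        by (intro mult_left_mono) auto
      moreover have "cmod (of_real (?s z) * exp (- H i z) - of_real (?s z))
          = ?s z * cmod (exp (- H i z) - 1)"
      proof -
        have "of_real (?s z) * exp (- H i z) - of_real (?s z)
            = of_real (?s z) * (exp (- H i z) - 1)" by (simp add: algebra_simps)
        then show ?thesis by (simp add: norm_mult norm_power)
      qed
      ultimately show "cmod (of_real (?s z) * exp (- H i z) - of_real (?s z))
          \<le> (\<Sum>k\<in>{i..<q}. ?s z * cmod (\<phi> k z))"
        by (simp add: sum_distrib_left)
    qed (use i in \<open>auto intro!: continuous_intros cont\<close>)
    also have "\<dots> = (\<Sum>k\<in>{i..<q}. circle_mean (\<lambda>z. ?s z * cmod (\<phi> k z)))"
      using i by (intro circle_mean_sum continuous_intros cont) auto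
    also have "\<dots> \<le> (\<Sum>k\<in>{i..<q}. 9 / 2 * c * \<kappa> * 8 ^ i * (1 / 2 ^ k))"
    proof (rule sum_mono)
      fix k assume "k \<in> {i..<q}"
      with i have k: "k \<in> {p..<q}" by auto
      \<comment> \<open>the value of \<open>t\<close> balancing the two terms of the upper bound\<close>
      define t where "t = c / (\<kappa> * 2 ^ k * 8 ^ i)"
      have t: "t > 0" using c \<kappa> by (simp add: t_def)
      have pow: "(64::real) ^ i = 8 ^ i * 8 ^ i" "(4::real) ^ k = 2 ^ k * 2 ^ k"
        by (simp_all flip: power_mult_distrib)
      have "circle_mean (\<lambda>z. ?s z * cmod (\<phi> k z))
          \<le> t / 2 * additive_energy (B i) + circle_mean (\<lambda>z. (cmod (\<phi> k z))\<^sup>2) / (2 * t)"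
        by (rule circle_mean_trig_sum_sq_mult_le[OF fin[OF i] cont[OF k] t])
      also have "\<dots> \<le> t / 2 * (\<kappa>\<^sup>2 * 64 ^ i) + 8 * c\<^sup>2 / 4 ^ k / (2 * t)"
        using energy[OF i] sq[OF k] t by (intro add_mono mult_left_mono divide_right_mono) auto
      \<comment> \<open>The two terms are \<open>1 / 2\<close> and \<open>4\<close> times
        \<open>c * \<kappa> * 8 ^ i / 2 ^ k\<close>.\<close>
      also have "\<dots> = 9 / 2 * c * \<kappa> * 8 ^ i * (1 / 2 ^ k)"
        using c \<kappa> by (simp add: t_def pow power2_eq_square field_simps)
      finally show "circle_mean (\<lambda>z. ?s z * cmod (\<phi> k z))
          \<le> 9 / 2 * c * \<kappa> * 8 ^ i * (1 / 2 ^ k)" .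
    qed
    also have "\<dots> = 9 / 2 * c * \<kappa> * 8 ^ i * (\<Sum>k\<in>{i..<q}. 1 / 2 ^ k)"
      by (rule sum_distrib_left[symmetric])
    \<comment> \<open>The geometric growth of the blocks makes the sum over \<open>k\<close>
      comparable to its first term, so the error has the order of the main term \<open>4 ^ i\<close>
      and does not depend on the number of blocks.\<close>
    also have "\<dots> \<le> 9 / 2 * c * \<kappa> * 8 ^ i * (2 / 2 ^ i)"
      using c \<kappa> by (intro mult_left_mono sum_inverse_power_two_le) auto
    also have "\<dots> = 9 * c * \<kappa> * (8 / 2) ^ i"
      unfolding power_divide by simp
    also have "\<dots> \<le> 1 / 2 * 4 ^ i"
      using c\<kappa> mult_right_mono[of "9 * c * \<kappa>" "1 / 2" "4 ^ i"] by simp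
    finally have "cmod (X - 4 ^ i) \<le> 4 ^ i / 2" by simp
    then have "4 ^ i / 2 \<le> Re X"
      using abs_Re_le_cmod[of "X - 4 ^ i"] by (simp add: abs_le_iff)
    moreover have "circle_mean (\<lambda>z. g i z * exp (- H i z) * cnj (trig_sum A z))
        = of_real (c / 4 ^ i) * X"
    proof -
      have "circle_mean (\<lambda>z. g i z * exp (- H i z) * cnj (trig_sum A z))
         = circle_mean (\<lambda>z. of_real (c / 4 ^ i) *
             (trig_sum (B i) z * exp (- H i z) * cnj (trig_sum A z)))"
        by (simp add: g_def mult.assoc)
      also have "\<dots> = of_real (c / 4 ^ i) *
          circle_mean (\<lambda>z. trig_sum (B i) z * exp (- H i z) * cnj (trig_sum A z))"
        by (intro circle_mean_mult_left continuous_intros)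
      also have "circle_mean (\<lambda>z. trig_sum (B i) z * exp (- H i z) * cnj (trig_sum A z)) = X"
        unfolding X_def
        by (intro circle_mean_top_subset A sub[OF i] top[OF i] holomorphic_intros H_hol[OF i])
      finally show ?thesis .
    qed
    ultimately show ?thesis
      using c by (simp add: field_simps del: of_real_divide)
  qed

  have "real (q - p) * (c / 2) = (\<Sum>i\<in>{p..<q}. c / 2)" by simp
  also have "\<dots> \<le> (\<Sum>i\<in>{p..<q}. Re (circle_mean (\<lambda>z. g i z * exp (- H i z) * cnj (trig_sum A z))))"
    by (intro sum_mono block)
  also have "\<dots> = Re (circle_mean (\<lambda>z. \<Sum>i\<in>{p..<q}. g i z * exp (- H i z) * cnj (trig_sum A z)))"
    by (subst circle_mean_sum) (auto intro!: continuous_intros H_cont g_cont)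
  also have "\<dots> = Re (circle_mean (\<lambda>z. F z * cnj (trig_sum A z)))"
    by (simp add: F_def sum_distrib_right)
  also have "\<dots> \<le> cmod (circle_mean (\<lambda>z. F z * cnj (trig_sum A z)))"
    by (rule complex_Re_le_cmod)
  also have "\<dots> \<le> circle_mean (\<lambda>z. cmod (trig_sum A z))"
  proof (rule norm_circle_mean_le)
    fix z :: complex assume z: "cmod z = 1"
    have "cmod (F z) \<le> 1"
      unfolding F_def H_def by (intro norm_damped_sum_le_one norm_g z)
    then show "cmod (F z * cnj (trig_sum A z)) \<le> cmod (trig_sum A z)"
      by (simp add: norm_mult mult_left_le_one_le)
  qed (auto simp: F_def intro!: continuous_intros H_cont g_cont)
  finally show ?thesis
    by (simp add: fourier_ind_L1_eq)
qed

section \<open>Choice of scales and constants\<close>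

theorem theorem1p2:
  shows "\<exists>(N0::nat) (c1::real) (c2::real). c1 > 0 \<and> c2 > 0 \<and>
    (\<forall>(N::nat) (\<delta>::real) (K::real) (A::int set).
       N \<ge> N0 \<longrightarrow> 0 < \<delta> \<longrightarrow> \<delta> \<le> 1 / 2 \<longrightarrow> K > 0 \<longrightarrow>
       finite A \<longrightarrow> card A = N \<longrightarrow> fourier_ind_L1 A \<le> K * ln (real N) \<longrightarrow>
       (\<exists>A'. A' \<subseteq> A \<and> real (card A') \<ge> c1 * real N powr (1 - \<delta>) \<and>
             normalised_energy A' \<ge> c2 * (\<delta> / K)\<^sup>2))"
\<comment> \<open>The factor \<open>1/4\<close> pays for rounding \<open>N\<close> to a power of 4.
  The number 144 is \<open>18 * 8\<close>: with \<open>c = 8 * K / \<delta>\<close> and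
  \<open>\<kappa> = \<delta> / (144 * K)\<close> one has \<open>18 * c * \<kappa> = 1\<close>. The
  bound \<open>N \<ge> 2\<close> makes \<open>ln N\<close> positive.\<close>
proof (rule exI[of _ 2], rule exI[of _ "1/4"], rule exI[of _ "(1/144)\<^sup>2"],
    intro conjI allI impI)
  show "(1/4 :: real) > 0" "((1/144)\<^sup>2 :: real) > 0" by simp_all
  fix N :: nat and \<delta> K :: real and A :: "int set"
  assume N: "2 \<le> N" and \<delta>: "0 < \<delta>" "\<delta> \<le> 1 / 2" and K: "0 < K"
    and A: "finite A" "card A = N" and L1: "fourier_ind_L1 A \<le> K * ln (real N)"
  define \<kappa> where "\<kappa> = \<delta> / (144 * K)"
  have \<kappa>: "\<kappa> > 0" using \<delta> K by (simp add: \<kappa>_def)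
  show "\<exists>A'\<subseteq>A. 1/4 * real N powr (1 - \<delta>) \<le> real (card A') \<and>
      (1/144)\<^sup>2 * (\<delta> / K)\<^sup>2 \<le> normalised_energy A'"
  proof (rule ccontr)
    assume neg: "\<not> ?thesis"
    have "\<kappa>\<^sup>2 = (1/144)\<^sup>2 * (\<delta> / K)\<^sup>2"
      by (simp add: \<kappa>_def power_divide power_mult_distrib)
    with neg have small: "normalised_energy A' < \<kappa>\<^sup>2"
      if "A' \<subseteq> A" "1/4 * real N powr (1 - \<delta>) \<le> real (card A')" for A'
      using that by (metis not_le)
    obtain n where n: "4 ^ n \<le> N" "N < 4 ^ (n + 1)"
      using ex_power_ivl1[of 4 N] N by auto
    \<comment> \<open>The scales used are \<open>n - m, ..., n\<close>; these are
      \<open>m + 1\<close> blocks, more than \<open>x\<close>.\<close>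
    define x where "x = \<delta> * log 4 N"
    define m where "m = nat \<lfloor>x\<rfloor>"
    have "log 4 N < n + 1"
    proof -
      have "real N < 4 ^ (n + 1)"
        using n(2) by (metis of_nat_less_iff of_nat_numeral of_nat_power)
      also have "\<dots> = 4 powr real (n + 1)"
        by (rule powr_realpow[symmetric]) simp
      finally show ?thesis
        using N by (subst log_less_iff) auto
    qed
    moreover have log_nonneg: "log 4 N \<ge> 0" using N by simp
    \<comment> \<open>Here \<open>\<delta> \<le> 1 / 2\<close> enters; it yields
      \<open>m \<le> n\<close>, so that the natural number \<open>n - m\<close> is not
      truncated.\<close>
    ultimately have "x < (n + 1) / 2"
      unfolding x_def using \<delta> mult_right_mono[of \<delta> "1/2" "log 4 N"] by simp
    have "x \<ge> 0" unfolding x_def using \<delta> log_nonneg by simp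
    then have m: "real m \<le> x" "x < real m + 1"
      unfolding m_def by linarith+
    with \<open>x < (n + 1) / 2\<close> have "real (2 * m) < real (n + 1)" by simp
    then have "m \<le> n" unfolding of_nat_less_iff by simp

    have "\<exists>B\<subseteq>A. card B = 4 ^ i \<and> (\<forall>a\<in>A - B. \<forall>b\<in>B. a < b)" if "i \<in> {n - m..<n + 1}" for i
    proof (rule exists_top_subset[OF A(1)])
      have "(4::nat) ^ i \<le> 4 ^ n" using that by (intro power_increasing) auto
      also note n(1)
      finally show "4 ^ i \<le> card A" unfolding A(2) .
    qed
    then obtain B where B: "\<And>i. i \<in> {n - m..<n + 1} \<Longrightarrow>
        B i \<subseteq> A \<and> card (B i) = 4 ^ i \<and> (\<forall>a\<in>A - B i. \<forall>b\<in>B i. a < b)"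
      by metis
    \<comment> \<open>Already the smallest block is large enough for the negated conclusion:
      \<open>N \<le> 4 * 4 ^ (n - m) * 4 ^ m\<close> and \<open>4 ^ m \<le> N powr \<delta>\<close>
      give \<open>4 ^ i \<ge> N powr (1 - \<delta>) / 4\<close>.\<close>
    have energy: "real (additive_energy (B i)) \<le> \<kappa>\<^sup>2 * 64 ^ i" if i: "i \<in> {n - m..<n + 1}" for i
    proof -
      have "4 ^ m = 4 powr real m" by (simp add: powr_realpow)
      also have "\<dots> \<le> 4 powr x" using m by (intro powr_mono) auto
      also have "\<dots> = real N powr \<delta>"
        using N by (simp add: x_def mult.commute[of \<delta>] powr_powr[symmetric])
      finally have 1: "4 ^ m \<le> real N powr \<delta>" .
      have "real N \<le> 4 ^ (n + 1)" using n(2) by (metis of_nat_less_iff of_nat_numeral of_nat_power less_imp_le)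
      also have "\<dots> = 4 * 4 ^ (n - m) * 4 ^ m"
        using \<open>m \<le> n\<close> by (simp flip: power_add)
      also have "\<dots> \<le> 4 * 4 ^ i * real N powr \<delta>"
        using 1 i by (intro mult_mono power_increasing) auto
      finally have "1/4 * real N powr (1 - \<delta>) \<le> 4 ^ i"
        using N by (simp add: powr_diff field_simps)
      then have "normalised_energy (B i) < \<kappa>\<^sup>2"
        using B[OF i] by (intro small) auto
      moreover have "real (card (B i)) ^ 3 = 64 ^ i"
        using B[OF i] by (simp flip: power_mult add: mult.commute[of i]) (simp add: power_mult)
      ultimately show ?thesis
        by (simp add: normalised_energy_def field_simps)
    qed
    have "real (n + 1 - (n - m)) * (8 * K / \<delta> / 2) \<le> fourier_ind_L1 A"
      by (rule fourier_ind_L1_ge_of_small_energy[where B = B and \<kappa> = \<kappa>])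
         (use B A energy \<kappa> \<delta> K in \<open>auto simp: \<kappa>_def\<close>)
    \<comment> \<open>The number of blocks is \<open>m + 1 > x\<close>, and
      \<open>ln 4 \<le> 2\<close> converts the logarithm to base 4.\<close>
    moreover have "\<delta> * (ln N / 2) \<le> real (n + 1 - (n - m))"
    proof -
      have "ln (4::real) = 2 * ln 2"
        using ln_realpow[of 2 2] by simp
      then have "ln (4::real) \<le> 2" using ln_2_less_1 by simp
      then have "ln N / 2 \<le> log 4 N"
        unfolding log_def using N by (intro divide_left_mono) auto
      then have "\<delta> * (ln N / 2) \<le> x"
        unfolding x_def using \<delta> by (intro mult_left_mono) auto
      moreover have "real (n + 1 - (n - m)) = real m + 1"
        using \<open>m \<le> n\<close> by simp
      ultimately show ?thesis using m(2) by linarith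
    qed
    moreover have "8 * K / \<delta> / 2 \<ge> 0" using \<delta> K by simp
    ultimately have "\<delta> * (ln N / 2) * (8 * K / \<delta> / 2) \<le> fourier_ind_L1 A"
      by (meson mult_right_mono order_trans)
    \<comment> \<open>The total is twice the assumed upper bound, which is positive: a
      contradiction.\<close>
    moreover have "\<delta> * (ln N / 2) * (8 * K / \<delta> / 2) = 2 * (K * ln N)"
      using \<delta> by simp
    moreover have "K * ln N > 0" using K N by simp
    ultimately show False using L1 by linarith
  qed
qed

end
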